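(* For every $n\geq 2$ and every finite set $F \subset \mathbb{A}^n$ of $l$ points, there exists a morphism $f: \mathbb{A}^n \to \mathbb{A}^n$ such that $f(\mathbb{A}^n)= \mathbb{A}^n\setminus F$. Moreover, if $l>2$, then there exists such an $f$ with $\deg(f) \leq (l-1)\cdot (l+2)$; and if $F$ is a subset of a line, then there exists such an $f$ with $\deg(f) = l+2$.
   Context: All varieties are over an algebraically closed field $\mathbb{K}$ of characteristic zero, and $\mathbb{A}^n$ denotes affine $n$-space over $\mathbb{K}$. A morphism $f=(f_1,\ldots,f_n):\mathbb{A}^n\to\mathbb{A}^n$ is a polynomial map, and its degree $\deg(f)$ is the maximum of the total degrees of $f_1,\ldots,f_n$. A line is an affine line in $\mathbb{A}^n$ (a one-dimensional affine linear subspace). *)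

theory Defs
  imports
    "HOL-Analysis.Cartesian_Space"
    "HOL-Library.Poly_Mapping"
    "HOL-Computational_Algebra.Polynomial"
begin

text \<open>Polynomials over \<open>'k\<close> in variables indexed by the finite type \<open>'n\<close>: finitely supported
  families of coefficients, indexed by exponent vectors.\<close>

type_synonym ('n, 'k) mpoly = "('n \<Rightarrow>\<^sub>0 nat) \<Rightarrow>\<^sub>0 'k"

definition mpoly_eval :: "('n::finite, 'k::field) mpoly \<Rightarrow> 'k ^ 'n \<Rightarrow> 'k" where
  "mpoly_eval p x =
     (\<Sum>m\<in>Poly_Mapping.keys p. Poly_Mapping.lookup p m * (\<Prod>i\<in>UNIV. (x $ i) ^ Poly_Mapping.lookup m i))"

definition monomial_degree :: "('n::finite \<Rightarrow>\<^sub>0 nat) \<Rightarrow> nat" where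
  "monomial_degree m = (\<Sum>i\<in>UNIV. Poly_Mapping.lookup m i)"

text \<open>The zero polynomial gets total degree \<open>0\<close>.\<close>

definition total_degree :: "('n::finite, 'k::field) mpoly \<Rightarrow> nat" where
  "total_degree p = Max (insert 0 (monomial_degree ` Poly_Mapping.keys p))"

text \<open>A morphism from affine \<open>'n\<close>-space to itself is given by its tuple of coordinate polynomials.
  Over an infinite field this tuple is determined by the induced map on points.\<close>

type_synonym ('n, 'k) morphism = "(('n, 'k) mpoly) ^ 'n"

definition morphism_map :: "('n::finite, 'k::field) morphism \<Rightarrow> 'k ^ 'n \<Rightarrow> 'k ^ 'n" where
  "morphism_map f x = (\<chi> i. mpoly_eval (f $ i) x)"

definition morphism_degree :: "('n::finite, 'k::field) morphism \<Rightarrow> nat" where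
  "morphism_degree f = (MAX i. total_degree (f $ i))"

definition affine_line :: "('k::field ^ 'n::finite) set \<Rightarrow> bool" where
  "affine_line L \<longleftrightarrow> (\<exists>a V. vec.subspace V \<and> vec.dim V = 1 \<and> L = (\<lambda>v. a + v) ` V)"

end

theory Submission
  imports Defs
begin

text \<open>
  Let \<open>S\<close> be a set of \<open>l\<close> scalars, \<open>p = \<Prod>s\<in>S. (X - s)\<close> and \<open>m = n - 1\<close>. Write the source
  coordinates as \<open>x, t\<^sub>1, \<dots>, t\<^sub>m\<close>, put \<open>t\<^sub>0 = 1\<close>, and consider the polynomials

    \<open>z\<^sub>j = t\<^sub>j p(x) - t\<^sub>j\<^sub>-\<^sub>1\<close>  for \<open>1 \<le> j \<le> m\<close>,   and   \<open>v = x + \<Sum>j. z\<^sub>j t\<^sub>j\<close>,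

  of degrees at most \<open>l + 1\<close> and \<open>l + 2\<close>. The map \<open>(z, v)\<close> omits exactly the points \<open>(0, s)\<close> with
  \<open>s \<in> S\<close>. Over \<open>z = 0\<close> the first equation reads \<open>t\<^sub>1 p(x) = 1\<close>, so \<open>x\<close> avoids \<open>S\<close>, and \<open>v = x\<close>;
  conversely every \<open>x\<close> outside \<open>S\<close> extends to a solution. Over a fixed \<open>z \<noteq> 0\<close> and where
  \<open>p(x) \<noteq> 0\<close>, the equations determine each \<open>t\<^sub>j\<close> as a polynomial in \<open>1/p(x)\<close>, so that
  \<open>v = x + G(1/p(x))\<close>. The degrees of the \<open>t\<^sub>j\<close> in \<open>1/p(x)\<close> increase strictly at the indices
  \<open>j \<ge> 2\<close> with \<open>z\<^sub>j \<noteq> 0\<close>, so the last of these summands cannot cancel; hence \<open>G\<close> is nonconstant, except for \<open>z = (-1, 0, \<dots>, 0)\<close>, where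
  \<open>t = 0\<close> and \<open>v = x\<close> is onto by inspection (\<open>chain_sum_eq_0_imp\<close>). A nonconstant \<open>G\<close> gives
  \<open>v\<close> a pole at every point of \<open>S\<close>; clearing denominators in \<open>v = b\<close> then yields a nonconstant
  polynomial in \<open>x\<close> with no root in \<open>S\<close>, so algebraic closedness provides a solution
  (\<open>exists_solution_with_pole\<close>, \<open>chain_system_solvable_iff\<close>).

  It remains to move the \<open>l\<close> omitted points on a coordinate line to \<open>F\<close>. Choose a linear form
  \<open>\<lambda>\<close> and a polynomial curve \<open>g\<close> with \<open>\<lambda>(g(s)) = s\<close> and \<open>F = g(S)\<close>. The map
  \<open>(z, v) \<mapsto> g(v) + Z\<close>, where \<open>z\<close> serves as coordinates on the kernel of \<open>\<lambda>\<close> and \<open>Z\<close> is the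
  corresponding vector, is bijective with inverse read off from \<open>v = \<lambda>(w)\<close> and \<open>Z = w - g(v)\<close>.
  The degree of the composite is at most the degree of the curve times \<open>l + 2\<close>
  (\<open>ex_morphism_omitting_curve_points\<close>). For an arbitrary \<open>F\<close> a generic \<open>\<lambda>\<close> separates its points
  and interpolation gives a curve of degree at most \<open>max 1 (l - 1)\<close>; for \<open>F\<close> on a line the curve
  is that line.

  The degree is never below \<open>l + 2\<close>, because \<open>v\<close> is a linear combination of the coordinates of the
  composite, and on the line \<open>x = t\<^sub>1 = s\<close>, \<open>t\<^sub>2 = \<dots> = t\<^sub>m = 0\<close> it equals \<open>s\<^sup>2 p(s)\<close>.
\<close>

section \<open>Polynomial functions\<close>

lemma total_degree_le_iff:
  "total_degree p \<le> d \<longleftrightarrow> (\<forall>m\<in>Poly_Mapping.keys p. monomial_degree m \<le> d)"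
  by (simp add: total_degree_def)

lemma mpoly_eval_superset:
  assumes "finite A" "Poly_Mapping.keys p \<subseteq> A"
  shows "mpoly_eval p x =
    (\<Sum>m\<in>A. Poly_Mapping.lookup p m * (\<Prod>i\<in>UNIV. (x $ i) ^ Poly_Mapping.lookup m i))"
  unfolding mpoly_eval_def using assms
  by (intro sum.mono_neutral_left) (auto simp: in_keys_iff)

lemma mpoly_eval_zero [simp]: "mpoly_eval 0 x = 0"
  by (simp add: mpoly_eval_def)

lemma mpoly_eval_add: "mpoly_eval (p + q) x = mpoly_eval p x + mpoly_eval q x"
proof -
  let ?A = "Poly_Mapping.keys p \<union> Poly_Mapping.keys q"
  have "Poly_Mapping.keys (p + q) \<subseteq> ?A" by (rule keys_add)
  then show ?thesis
    by (simp add: mpoly_eval_superset[of ?A] lookup_add sum.distrib distrib_right)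
qed

lemma mpoly_eval_sum: "mpoly_eval (sum f A) x = (\<Sum>a\<in>A. mpoly_eval (f a) x)"
  by (induction A rule: infinite_finite_induct) (simp_all add: mpoly_eval_add)

lemma mpoly_eval_single:
  "mpoly_eval (Poly_Mapping.single m c) x = c * (\<Prod>i\<in>UNIV. (x $ i) ^ Poly_Mapping.lookup m i)"
  by (cases "c = 0") (simp_all add: mpoly_eval_def)

lemma mpoly_eq_sum_singles:
  "p = (\<Sum>m\<in>Poly_Mapping.keys p. Poly_Mapping.single m (Poly_Mapping.lookup p m))"
  by (rule poly_mapping_eqI) (auto simp: lookup_sum lookup_single when_def in_keys_iff)

lemma mpoly_eval_mult: "mpoly_eval (p * q) x = mpoly_eval p x * mpoly_eval q x"
proof -
  have "p * q = (\<Sum>m\<in>Poly_Mapping.keys p. \<Sum>m'\<in>Poly_Mapping.keys q.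
      Poly_Mapping.single (m + m') (Poly_Mapping.lookup p m * Poly_Mapping.lookup q m'))"
    by (subst mpoly_eq_sum_singles[of p], subst mpoly_eq_sum_singles[of q])
       (simp add: sum_product mult_single)
  then have "mpoly_eval (p * q) x = (\<Sum>m\<in>Poly_Mapping.keys p. \<Sum>m'\<in>Poly_Mapping.keys q.
      Poly_Mapping.lookup p m * Poly_Mapping.lookup q m' *
      (\<Prod>i\<in>UNIV. (x $ i) ^ Poly_Mapping.lookup (m + m') i))"
    by (simp only: mpoly_eval_sum mpoly_eval_single)
  then show ?thesis
    by (simp add: lookup_add power_add prod.distrib mpoly_eval_def sum_product mult_ac)
qed

text \<open>
  The index only bounds the total degree. The calculus of such bounds then needs no attention to
  cancellation, and exact degrees are recovered by restriction to lines.
\<close>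

definition polynomial_function :: "nat \<Rightarrow> ('k::field ^ 'n::finite \<Rightarrow> 'k) \<Rightarrow> bool" where
  "polynomial_function d h \<longleftrightarrow>
     (\<exists>p :: ('n, 'k) mpoly. (\<forall>x. mpoly_eval p x = h x) \<and> total_degree p \<le> d)"

lemma polynomial_function_mono:
  "polynomial_function d h \<Longrightarrow> d \<le> d' \<Longrightarrow> polynomial_function d' h"
  unfolding polynomial_function_def using order_trans by blast

lemma polynomial_function_const:
  "polynomial_function d (\<lambda>x :: 'k::field ^ 'n::finite. c)"
proof -
  have "mpoly_eval (Poly_Mapping.single 0 c) x = c" for x :: "'k ^ 'n"
    by (simp add: mpoly_eval_single)
  moreover have "total_degree (Poly_Mapping.single (0 :: 'n \<Rightarrow>\<^sub>0 nat) c) \<le> d"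
    by (simp add: total_degree_le_iff monomial_degree_def)
  ultimately show ?thesis unfolding polynomial_function_def by blast
qed

lemma polynomial_function_coordinate:
  "polynomial_function 1 (\<lambda>x :: 'k::field ^ 'n::finite. x $ i)"
proof -
  let ?m = "Poly_Mapping.single i 1 :: 'n \<Rightarrow>\<^sub>0 nat"
  have "(\<Prod>j\<in>UNIV. (x $ j) ^ Poly_Mapping.lookup ?m j) = (\<Prod>j\<in>UNIV. if i = j then x $ j else 1)"
    for x :: "'k ^ 'n"
    by (rule prod.cong) (auto simp: lookup_single)
  then have "mpoly_eval (Poly_Mapping.single ?m 1) x = x $ i" for x :: "'k ^ 'n"
    by (simp add: mpoly_eval_single)
  moreover have "total_degree (Poly_Mapping.single ?m (1 :: 'k)) \<le> 1"
    by (simp add: total_degree_le_iff monomial_degree_def lookup_single when_def)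
  ultimately show ?thesis unfolding polynomial_function_def by blast
qed

lemma polynomial_function_add:
  assumes "polynomial_function d h" "polynomial_function d h'"
  shows "polynomial_function d (\<lambda>x. h x + h' x)"
proof -
  obtain p q where "\<forall>x. mpoly_eval p x = h x" "total_degree p \<le> d"
    "\<forall>x. mpoly_eval q x = h' x" "total_degree q \<le> d"
    using assms by (auto simp: polynomial_function_def)
  moreover from this have "total_degree (p + q) \<le> d"
    using keys_add[of p q] by (auto simp: total_degree_le_iff)
  ultimately show ?thesis
    unfolding polynomial_function_def by (intro exI[of _ "p + q"]) (simp add: mpoly_eval_add)
qed

lemma polynomial_function_mult:
  assumes "polynomial_function d h" "polynomial_function d' h'"
  shows "polynomial_function (d + d') (\<lambda>x. h x * h' x)"
proof -
  obtain p q where p: "\<forall>x. mpoly_eval p x = h x" "total_degree p \<le> d"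
    and q: "\<forall>x. mpoly_eval q x = h' x" "total_degree q \<le> d'"
    using assms by (auto simp: polynomial_function_def)
  have "monomial_degree m \<le> d + d'" if m: "m \<in> Poly_Mapping.keys (p * q)" for m
  proof -
    obtain a b where "m = a + b" "a \<in> Poly_Mapping.keys p" "b \<in> Poly_Mapping.keys q"
      using m keys_mult[of p q] by blast
    moreover have "monomial_degree (a + b) = monomial_degree a + monomial_degree b"
      by (simp add: monomial_degree_def lookup_add sum.distrib)
    ultimately show ?thesis
      using p(2) q(2) by (auto simp: total_degree_le_iff intro: add_mono)
  qed
  with p(1) q(1) show ?thesis
    unfolding polynomial_function_def
    by (intro exI[of _ "p * q"]) (simp add: mpoly_eval_mult total_degree_le_iff)
qed

lemma polynomial_function_sum:
  "(\<And>a. a \<in> A \<Longrightarrow> polynomial_function d (h a)) \<Longrightarrow> polynomial_function d (\<lambda>x. \<Sum>a\<in>A. h a x)"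
  by (induction A rule: infinite_finite_induct)
     (simp_all add: polynomial_function_const polynomial_function_add)

lemma polynomial_function_cmult:
  "polynomial_function d h \<Longrightarrow> polynomial_function d (\<lambda>x. c * h x)"
  using polynomial_function_mult[OF polynomial_function_const[of 0 c]] by simp

lemma polynomial_function_uminus:
  "polynomial_function d h \<Longrightarrow> polynomial_function d (\<lambda>x. - h x)"
  using polynomial_function_cmult[of d h "-1"] by simp

lemma polynomial_function_diff:
  "polynomial_function d h \<Longrightarrow> polynomial_function d h' \<Longrightarrow> polynomial_function d (\<lambda>x. h x - h' x)"
  using polynomial_function_add[OF _ polynomial_function_uminus] by fastforce

lemma polynomial_function_poly:
  assumes h: "polynomial_function d h"
  shows "polynomial_function (degree q * d) (\<lambda>x. poly q (h x))"
proof -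
  have power: "polynomial_function (j * d) (\<lambda>x. h x ^ j)" for j
    by (induction j) (simp_all add: polynomial_function_const polynomial_function_mult h)
  show ?thesis
    unfolding poly_altdef
    by (intro polynomial_function_sum polynomial_function_cmult)
       (rule polynomial_function_mono[OF power], simp)
qed

text \<open>
  Along a line a monomial becomes a product of at most linear factors, one for each unit of its
  total degree. Hence a line on which a map has large degree bounds its total degree from below.
\<close>

lemma polynomial_function_on_line:
  assumes h: "polynomial_function d h" and u: "\<And>i. degree (u i) \<le> 1"
  obtains q where "degree q \<le> d" "\<And>s. poly q s = h (\<chi> i. poly (u i) s)"
proof -
  obtain p where p: "\<And>x. mpoly_eval p x = h x" "total_degree p \<le> d"
    using h by (auto simp: polynomial_function_def)
  define q where "q = (\<Sum>m\<in>Poly_Mapping.keys p.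
    smult (Poly_Mapping.lookup p m) (\<Prod>i\<in>UNIV. u i ^ Poly_Mapping.lookup m i))"
  have "degree (\<Prod>i\<in>UNIV. u i ^ Poly_Mapping.lookup m i) \<le> d" if "m \<in> Poly_Mapping.keys p" for m
  proof -
    have "degree (\<Prod>i\<in>UNIV. u i ^ Poly_Mapping.lookup m i)
        \<le> (\<Sum>i\<in>UNIV. degree (u i ^ Poly_Mapping.lookup m i))"
      using degree_prod_sum_le[of UNIV "\<lambda>i. u i ^ Poly_Mapping.lookup m i"]
      by (simp add: o_def)
    also have "\<dots> \<le> (\<Sum>i\<in>UNIV. Poly_Mapping.lookup m i)"
      by (intro sum_mono order_trans[OF degree_power_le]) (use u in simp)
    also have "\<dots> \<le> d"
      using p(2) that by (auto simp: total_degree_le_iff monomial_degree_def)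
    finally show ?thesis .
  qed
  then have "degree q \<le> d"
    unfolding q_def
    by (intro degree_sum_le) (auto intro: order_trans[OF degree_smult_le])
  moreover have "poly q s = h (\<chi> i. poly (u i) s)" for s
    by (simp add: q_def poly_sum poly_prod flip: p(1)) (simp add: mpoly_eval_def)
  ultimately show thesis using that by blast
qed

lemma morphism_degree_le_iff:
  "morphism_degree f \<le> d \<longleftrightarrow> (\<forall>i. total_degree (f $ i) \<le> d)"
  by (simp add: morphism_degree_def)

lemma polynomial_function_morphism_component:
  "polynomial_function (morphism_degree f) (\<lambda>x. morphism_map f x $ i)"
  unfolding polynomial_function_def
  using morphism_degree_le_iff[of f "morphism_degree f"]
  by (intro exI[of _ "f $ i"]) (simp add: morphism_map_def)

lemma morphism_of_polynomial_functions:
  assumes "\<And>i. polynomial_function d (\<lambda>x. \<Phi> x $ i)"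
  obtains f where "morphism_map f = \<Phi>" "morphism_degree f \<le> d"
proof -
  obtain P where P: "\<And>i x. mpoly_eval (P i) x = \<Phi> x $ i" "\<And>i. total_degree (P i) \<le> d"
    using assms unfolding polynomial_function_def by metis
  show thesis
    by (rule that[of "\<chi> i. P i"])
       (simp_all add: morphism_map_def morphism_degree_le_iff P fun_eq_iff vec_eq_iff)
qed

section \<open>Solving the chain of equations\<close>

text \<open>
  For prescribed values \<open>z\<close>, the equations \<open>t\<^sub>j p(x) - t\<^sub>j\<^sub>-\<^sub>1 = z\<^sub>j\<close> with \<open>t\<^sub>0 = 1\<close> are solved
  by the recursion \<open>t\<^sub>j = (t\<^sub>j\<^sub>-\<^sub>1 + z\<^sub>j) / p(x)\<close>. The polynomial \<open>chain z j\<close> is \<open>t\<^sub>j\<close> with the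
  variable standing for \<open>1/p(x)\<close>; multiplication by the variable is \<open>pCons 0\<close>.
\<close>

primrec chain :: "(nat \<Rightarrow> 'k::comm_ring_1) \<Rightarrow> nat \<Rightarrow> 'k poly" where
  "chain z 0 = 1"
| "chain z (Suc j) = pCons 0 (chain z j + [:z (Suc j):])"

definition chain_sum :: "(nat \<Rightarrow> 'k::comm_ring_1) \<Rightarrow> nat \<Rightarrow> 'k poly" where
  "chain_sum z m = (\<Sum>j=1..m. smult (z j) (chain z j))"

lemma chain_sum_Suc:
  "chain_sum z (Suc m) = chain_sum z m + smult (z (Suc m)) (chain z (Suc m))"
  by (simp add: chain_sum_def)

text \<open>
  For \<open>m \<ge> 1\<close> the polynomial \<open>chain z m\<close> has no constant term, so adding \<open>z (Suc m)\<close> does not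
  lower its degree and cannot give zero. Multiplication by the variable then raises the degree.
\<close>

lemma degree_chain_less:
  fixes z :: "nat \<Rightarrow> 'k::idom"
  assumes "m \<ge> 1" "z (Suc m) \<noteq> 0"
  shows "degree (chain z m) < degree (chain z (Suc m))"
proof (cases "chain z m = 0")
  case True
  then show ?thesis using assms by simp
next
  case False
  have "degree (chain z m) \<ge> 1"
    using False assms(1) by (cases m) (auto simp: split: if_splits)
  then have *: "degree (chain z m + [:z (Suc m):]) = degree (chain z m)"
    by (intro degree_add_eq_left) simp
  moreover from * \<open>degree (chain z m) \<ge> 1\<close> have "chain z m + [:z (Suc m):] \<noteq> 0" by auto
  ultimately show ?thesis by simp
qed

lemma degree_chain_sum_le:
  fixes z :: "nat \<Rightarrow> 'k::idom"
  assumes "m \<ge> 1"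
  shows "degree (chain_sum z m) \<le> degree (chain z m)"
  using assms
proof (induction m rule: nat_induct_at_least)
  case base
  show ?case by (simp add: chain_sum_def)
next
  case (Suc m)
  show ?case
  proof (cases "z (Suc m) = 0")
    case True
    with Suc.IH show ?thesis
      by (cases "chain z m = 0") (simp_all add: chain_sum_Suc)
  next
    case False
    with Suc degree_chain_less[of m z] have "degree (chain_sum z m) \<le> degree (chain z (Suc m))"
      by linarith
    then show ?thesis
      unfolding chain_sum_Suc by (intro degree_add_le order_trans[OF degree_smult_le]) simp_all
  qed
qed

text \<open>
  A nonzero value \<open>z (Suc m)\<close> contributes a summand of higher degree than everything before it,
  so it cannot be cancelled. Thus a vanishing sum forces the values to vanish from the last one
  downwards, until the single summand \<open>z 1 * (1 + z 1)\<close> times the variable is left.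
\<close>

lemma chain_sum_eq_0_imp:
  fixes z :: "nat \<Rightarrow> 'k::idom"
  assumes "m \<ge> 1" "chain_sum z m = 0"
  shows "(z 1 = 0 \<or> z 1 = -1) \<and> (\<forall>j\<in>{2..m}. z j = 0)"
  using assms
proof (induction m rule: nat_induct_at_least)
  case base
  then show ?case by (simp add: chain_sum_def add_eq_0_iff one_pCons)
next
  case (Suc m)
  have "z (Suc m) = 0"
  proof (rule ccontr)
    assume nz: "z (Suc m) \<noteq> 0"
    with Suc.hyps have "degree (chain_sum z m) < degree (smult (z (Suc m)) (chain z (Suc m)))"
      using le_less_trans[OF degree_chain_sum_le[of m z] degree_chain_less[of m z]]
      by (simp del: chain.simps)
    then have "degree (chain_sum z (Suc m)) = degree (smult (z (Suc m)) (chain z (Suc m)))"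
      unfolding chain_sum_Suc by (rule degree_add_eq_right)
    with Suc.prems nz degree_chain_less[of m z, OF Suc.hyps nz] show False by (simp del: chain.simps)
  qed
  with Suc show ?case by (auto simp: chain_sum_Suc le_Suc_eq)
qed

lemma poly_chain_sum_0: "poly (chain_sum z m) 0 = 0"
proof -
  have "poly (chain z j) 0 = 0" if "j \<ge> 1" for j
    using that by (cases j) simp_all
  then show ?thesis by (simp add: chain_sum_def poly_sum)
qed

text \<open>
  Let \<open>N = degree G\<close>. Multiplying \<open>x - b + G(1/p(x)) = 0\<close> by \<open>p(x)\<^sup>N\<close> gives a polynomial
  equation. Its degree is positive, as the summand \<open>(x - b) p(x)\<^sup>N\<close> has degree \<open>1 + N deg p\<close> and
  the other summand has degree at most \<open>N deg p\<close>. At a zero of \<open>p\<close>, since \<open>N > 0\<close>, the left hand side is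
  the leading coefficient of \<open>G\<close>, so no root is a zero of \<open>p\<close>.
\<close>

lemma exists_solution_with_pole:
  fixes p G :: "'k::alg_closed_field poly"
  assumes "p \<noteq> 0" "degree G > 0"
  obtains x where "poly p x \<noteq> 0" "x + poly G (inverse (poly p x)) = b"
proof -
  define N where "N = degree G"
  \<comment> \<open>\<open>reflect_poly G \<circ>\<^sub>p p\<close> is \<open>p\<^sup>N G(1/p)\<close>.\<close>
  define H where "H = [:-b, 1:] * p ^ N + reflect_poly G \<circ>\<^sub>p p"
  have "degree (reflect_poly G \<circ>\<^sub>p p) \<le> N * degree p"
    unfolding N_def by (intro order_trans[OF degree_pcompose_le] mult_right_mono degree_reflect_poly_le) simp
  moreover have "degree ([:-b, 1:] * p ^ N) = Suc (N * degree p)"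
    using assms by (subst degree_mult_eq) (auto simp: degree_power_eq)
  ultimately have "degree H > 0"
    unfolding H_def by (subst degree_add_eq_left) simp_all
  then obtain x where x: "poly H x = 0"
    using alg_closed_imp_poly_has_root by blast
  have nz: "poly p x \<noteq> 0"
  proof
    assume "poly p x = 0"
    with x assms(2) have "lead_coeff G = 0"
      by (simp add: H_def N_def poly_pcompose zero_power)
    with assms(2) show False by auto
  qed
  moreover have "x + poly G (inverse (poly p x)) = b"
  proof -
    have "poly p x ^ N * (x - b + poly G (inverse (poly p x))) = 0"
      using x nz by (simp add: H_def N_def poly_pcompose poly_reflect_poly_nz algebra_simps)
    with nz have "x - b + poly G (inverse (poly p x)) = 0" by simp
    then show ?thesis by (simp add: algebra_simps)
  qed
  ultimately show thesis using that by blast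
qed

text \<open>
  The image of \<open>(x, t) \<mapsto> (z, v)\<close>. If \<open>chain_sum z m\<close> is nonzero, it has no constant term and
  hence is nonconstant, and the pole argument applies. If it is zero, then either
  \<open>z = 0\<close>, where \<open>t\<^sub>j = 1/p(b)\<^sup>j\<close> is the solution, or \<open>z = (-1, 0, \<dots>, 0)\<close>, where
  \<open>x = b\<close> and \<open>t\<^sub>1 = \<dots> = t\<^sub>m = 0\<close> is a solution even if \<open>p(b) = 0\<close>.
\<close>

lemma chain_system_solvable_iff:
  fixes p :: "'k::alg_closed_field poly" and m :: nat
  assumes p: "p \<noteq> 0" and m: "m \<ge> 1"
  shows "(\<exists>x t. t 0 = 1 \<and> (\<forall>j\<in>{1..m}. t j * poly p x - t (j - 1) = z j) \<and>
             x + (\<Sum>j=1..m. z j * t j) = b)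
    \<longleftrightarrow> \<not> ((\<forall>j\<in>{1..m}. z j = 0) \<and> poly p b = 0)" (is "?solvable \<longleftrightarrow> \<not> ?missed")
proof
  assume ?solvable
  then obtain x t where t: "t 0 = 1" "\<forall>j\<in>{1..m}. t j * poly p x - t (j - 1) = z j"
    and b: "x + (\<Sum>j=1..m. z j * t j) = b" by blast
  show "\<not> ?missed"
  proof
    assume missed: ?missed
    with b have "x = b" by simp
    moreover have "1 \<in> {1..m}" using m by simp
    with t(2) missed have "t 1 * poly p x - t (1 - 1) = z 1" "z 1 = 0"
      by blast+
    with t(1) have "t 1 * poly p x = 1" by simp
    ultimately show False using missed by simp
  qed
next
  assume not_missed: "\<not> ?missed"
  show ?solvable
  proof (cases "chain_sum z m = 0")
    case False
    with poly_chain_sum_0[of z m] have "degree (chain_sum z m) > 0"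
      by (auto elim!: degree_eq_zeroE intro!: gr0I)
    with p obtain x where x: "poly p x \<noteq> 0"
      "x + poly (chain_sum z m) (inverse (poly p x)) = b"
      by (rule exists_solution_with_pole)
    define t where "t j = poly (chain z j) (inverse (poly p x))" for j
    have "t j * poly p x - t (j - 1) = z j" if "j \<in> {1..m}" for j
      using that x(1) by (cases j) (simp_all add: t_def field_simps)
    moreover have "x + (\<Sum>j=1..m. z j * t j) = b"
      using x(2) by (simp add: chain_sum_def poly_sum t_def)
    moreover have "t 0 = 1" by (simp add: t_def)
    ultimately show ?thesis by blast
  next
    case True
    with m have z: "z 1 = 0 \<or> z 1 = -1" "\<And>j. j \<in> {2..m} \<Longrightarrow> z j = 0"
      using chain_sum_eq_0_imp by blast+
    show ?thesis
    proof (cases "z 1 = 0")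
      case True
      with z(2) have z0: "z j = 0" if "j \<in> {1..m}" for j
        using that by (cases "j = 1") auto
      with not_missed have "poly p b \<noteq> 0" by blast
      moreover from this have "inverse (poly p b) ^ j * poly p b = inverse (poly p b) ^ (j - 1)"
        if "j \<in> {1..m}" for j
        using that by (cases j) simp_all
      ultimately show ?thesis using z0
        by (intro exI[of _ b] exI[of _ "\<lambda>j. inverse (poly p b) ^ j"]) simp
    next
      case False
      define t :: "nat \<Rightarrow> 'k" where "t j = (if j = 0 then 1 else 0)" for j
      have "t j * poly p b - t (j - 1) = z j" if "j \<in> {1..m}" for j
        using that z False by (cases "j = 1") (auto simp: t_def)
      moreover have "b + (\<Sum>j=1..m. z j * t j) = b"
        by (auto simp: t_def intro!: sum.neutral)
      moreover have "t 0 = 1" by (simp add: t_def)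
      ultimately show ?thesis by blast
    qed
  qed
qed

section \<open>The endomorphism\<close>

text \<open>
  The chain of equations needs the coordinates in some order, whereas the index type has none;
  \<open>coord\<close> and \<open>pos\<close> are mutually inverse numberings by \<open>0, \<dots>, m\<close>. Coordinate number \<open>0\<close> carries
  \<open>x\<close> and number \<open>j \<ge> 1\<close> carries \<open>t\<^sub>j\<close>. The last assumption says that the linear form \<open>lam\<close> is
  a left inverse of the curve \<open>g\<close>.
\<close>

locale numbered_coordinates =
  fixes coord :: "nat \<Rightarrow> 'n::finite" and pos :: "'n \<Rightarrow> nat" and m :: nat
    and p :: "'k::{alg_closed_field, field_char_0} poly" and lam :: "'n \<Rightarrow> 'k" and g :: "'n \<Rightarrow> 'k poly"
  assumes m_pos: "m \<ge> 1"
    and pos_le: "pos i \<le> m" and coord_pos: "coord (pos i) = i"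
    and pos_coord: "j \<le> m \<Longrightarrow> pos (coord j) = j"
    and p_nz: "p \<noteq> 0"
    and lam_1: "lam (coord 0) = 1"
    and lam_g: "(\<Sum>i\<in>UNIV. lam i * poly (g i) s) = s"
begin

definition T :: "'k ^ 'n \<Rightarrow> nat \<Rightarrow> 'k" where
  "T y j = (if j = 0 then 1 else y $ coord j)"

definition Z :: "'k ^ 'n \<Rightarrow> nat \<Rightarrow> 'k" where
  "Z y j = T y j * poly p (y $ coord 0) - T y (j - 1)"

definition V :: "'k ^ 'n \<Rightarrow> 'k" where
  "V y = y $ coord 0 + (\<Sum>j=1..m. Z y j * T y j)"

text \<open>
  This is \<open>g(v)\<close> plus the vector in the kernel of \<open>lam\<close> whose coordinates other than number \<open>0\<close>
  are the \<open>z\<^sub>j\<close>. Since \<open>lam\<close> has coefficient \<open>1\<close> at coordinate number \<open>0\<close>, membership in the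
  kernel determines the remaining coordinate.
\<close>

definition endo :: "'k ^ 'n \<Rightarrow> 'k ^ 'n" where
  "endo y = (\<chi> i. poly (g i) (V y) +
     (if i = coord 0 then - (\<Sum>j=1..m. lam (coord j) * Z y j) else Z y (pos i)))"

lemma coord_eq_iff: "j \<le> m \<Longrightarrow> coord j = coord 0 \<longleftrightarrow> j = 0"
  using pos_coord by (metis le0)

lemma sum_coordinates: "(\<Sum>i\<in>UNIV. h i) = h (coord 0) + (\<Sum>j=1..m. h (coord j))"
  for h :: "'n \<Rightarrow> 'k"
proof -
  have "(\<Sum>i\<in>UNIV. h i) = (\<Sum>j\<in>{0..m}. h (coord j))"
    by (rule sum.reindex_bij_witness[of _ coord pos]) (auto simp: coord_pos pos_coord pos_le)
  then show ?thesis by (simp add: sum.atLeast_Suc_atMost)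
qed

lemma functional_endo: "(\<Sum>i\<in>UNIV. lam i * endo y $ i) = V y"
proof -
  have "(\<Sum>i\<in>UNIV. lam i * (if i = coord 0 then - (\<Sum>j=1..m. lam (coord j) * Z y j) else Z y (pos i))) = 0"
    unfolding sum_coordinates by (simp add: lam_1 coord_eq_iff pos_coord)
  then show ?thesis
    by (simp add: endo_def distrib_left sum.distrib lam_g)
qed

lemma eq_curve_point_iff:
  "w = (\<chi> i. poly (g i) s) \<longleftrightarrow>
     s = (\<Sum>i\<in>UNIV. lam i * w $ i) \<and> (\<forall>j\<in>{1..m}. w $ coord j = poly (g (coord j)) s)"
proof
  assume "w = (\<chi> i. poly (g i) s)"
  then show "s = (\<Sum>i\<in>UNIV. lam i * w $ i) \<and> (\<forall>j\<in>{1..m}. w $ coord j = poly (g (coord j)) s)"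
    by (simp add: lam_g)
next
  assume w: "s = (\<Sum>i\<in>UNIV. lam i * w $ i) \<and> (\<forall>j\<in>{1..m}. w $ coord j = poly (g (coord j)) s)"
  then have "(\<Sum>i\<in>UNIV. lam i * w $ i) = (\<Sum>i\<in>UNIV. lam i * poly (g i) s)"
    by (simp add: lam_g)
  with w have 0: "w $ coord 0 = poly (g (coord 0)) s"
    unfolding sum_coordinates by (simp add: lam_1)
  have "w $ coord (pos i) = poly (g (coord (pos i))) s" for i
    using w 0 pos_le[of i] by (cases "pos i = 0") auto
  then show "w = (\<chi> i. poly (g i) s)" by (simp add: vec_eq_iff coord_pos)
qed

text \<open>
  The passage from \<open>(z, v)\<close> to the value of \<open>endo\<close> is invertible: \<open>lam\<close> recovers \<open>v\<close>, and
  subtracting \<open>g(v)\<close> recovers \<open>z\<close>.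
\<close>

lemma endo_eq_iff:
  fixes w :: "'k ^ 'n"
  defines "b \<equiv> \<Sum>i\<in>UNIV. lam i * w $ i"
  shows "endo y = w \<longleftrightarrow> V y = b \<and> (\<forall>j\<in>{1..m}. Z y j = w $ coord j - poly (g (coord j)) b)"
proof
  assume w: "endo y = w"
  have "V y = b" unfolding b_def w[symmetric] by (rule functional_endo[symmetric])
  moreover have "Z y j = w $ coord j - poly (g (coord j)) (V y)" if "j \<in> {1..m}" for j
    using that by (simp add: w[symmetric] endo_def coord_eq_iff pos_coord)
  ultimately show "V y = b \<and> (\<forall>j\<in>{1..m}. Z y j = w $ coord j - poly (g (coord j)) b)" by simp
next
  assume *: "V y = b \<and> (\<forall>j\<in>{1..m}. Z y j = w $ coord j - poly (g (coord j)) b)"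
  have eq: "endo y $ coord j = w $ coord j" if "j \<in> {1..m}" for j
    using that * by (simp add: endo_def coord_eq_iff pos_coord)
  have "(\<Sum>i\<in>UNIV. lam i * endo y $ i) = (\<Sum>i\<in>UNIV. lam i * w $ i)"
    using * by (simp add: functional_endo b_def)
  with eq have 0: "endo y $ coord 0 = w $ coord 0"
    unfolding sum_coordinates by (simp add: lam_1)
  have "endo y $ coord (pos i) = w $ coord (pos i)" for i
    using eq 0 pos_le[of i] by (cases "pos i = 0") auto
  then show "endo y = w" by (simp add: vec_eq_iff coord_pos)
qed

lemma ex_coordinates_iff:
  "(\<exists>y. V y = b \<and> (\<forall>j\<in>{1..m}. Z y j = z j)) \<longleftrightarrow>
   (\<exists>x t. t 0 = 1 \<and> (\<forall>j\<in>{1..m}. t j * poly p x - t (j - 1) = z j) \<and>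
             x + (\<Sum>j=1..m. z j * t j) = b)"
proof safe
  fix y assume "\<forall>j\<in>{1..m}. Z y j = z j"
  then show "\<exists>x t. t 0 = 1 \<and> (\<forall>j\<in>{1..m}. t j * poly p x - t (j - 1) = z j) \<and>
      x + (\<Sum>j=1..m. z j * t j) = V y"
    by (intro exI[of _ "y $ coord 0"] exI[of _ "T y"]) (simp add: T_def Z_def V_def)
next
  fix x t
  assume t: "t 0 = 1" "\<forall>j\<in>{1..m}. t j * poly p x - t (j - 1) = z j"
  define y where "y = (\<chi> i. if i = coord 0 then x else t (pos i))"
  have T: "T y j = t j" if "j \<le> m" for j
    using that t(1) by (auto simp: T_def y_def coord_eq_iff pos_coord)
  have "Z y j = z j" if "j \<in> {1..m}" for j
  proof -
    have "y $ coord 0 = x" by (simp add: y_def)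
    moreover have "j \<le> m" "j - 1 \<le> m" using that by auto
    ultimately show ?thesis using that t(2) by (simp add: Z_def T)
  qed
  moreover from this have "V y = x + (\<Sum>j=1..m. z j * t j)"
    by (simp add: V_def T) (simp add: y_def)
  ultimately show "\<exists>y. V y = x + (\<Sum>j=1..m. z j * t j) \<and> (\<forall>j\<in>{1..m}. Z y j = z j)" by blast
qed

lemma range_endo: "range endo = UNIV - (\<lambda>s. \<chi> i. poly (g i) s) ` {s. poly p s = 0}"
proof -
  have "w \<in> range endo \<longleftrightarrow> w \<notin> (\<lambda>s. \<chi> i. poly (g i) s) ` {s. poly p s = 0}" for w
  proof -
    define b where "b = (\<Sum>i\<in>UNIV. lam i * w $ i)"
    have "w \<in> range endo \<longleftrightarrow> (\<exists>y. endo y = w)" by auto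
    also have "\<dots> \<longleftrightarrow> \<not> ((\<forall>j\<in>{1..m}. w $ coord j - poly (g (coord j)) b = 0) \<and> poly p b = 0)"
      unfolding endo_eq_iff b_def[symmetric] ex_coordinates_iff
      by (rule chain_system_solvable_iff[OF p_nz m_pos])
    also have "\<dots> \<longleftrightarrow> w \<notin> (\<lambda>s. \<chi> i. poly (g i) s) ` {s. poly p s = 0}"
      unfolding image_iff eq_curve_point_iff b_def by auto
    finally show ?thesis .
  qed
  then show ?thesis by blast
qed

lemma polynomial_function_T: "polynomial_function 1 (\<lambda>y. T y j)"
  by (cases "j = 0")
     (use polynomial_function_coordinate in \<open>simp_all add: T_def polynomial_function_const\<close>)

lemma polynomial_function_Z: "polynomial_function (degree p + 1) (\<lambda>y. Z y j)"
proof -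
  have "polynomial_function (1 + degree p * 1) (\<lambda>y. T y j * poly p (y $ coord 0))"
    by (intro polynomial_function_mult polynomial_function_T polynomial_function_poly
        polynomial_function_coordinate)
  moreover have "polynomial_function (degree p + 1) (\<lambda>y. T y (j - 1))"
    by (rule polynomial_function_mono[OF polynomial_function_T]) simp
  ultimately show ?thesis
    unfolding Z_def by (intro polynomial_function_diff) simp_all
qed

lemma polynomial_function_V: "polynomial_function (degree p + 2) V"
proof -
  have "polynomial_function (degree p + 1 + 1) (\<lambda>y. Z y j * T y j)" for j
    by (intro polynomial_function_mult polynomial_function_T polynomial_function_Z)
  moreover have "polynomial_function (degree p + 2) (\<lambda>y :: 'k ^ 'n. y $ coord 0)"
    by (rule polynomial_function_mono[OF polynomial_function_coordinate]) simp
  ultimately show ?thesis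
    unfolding V_def[abs_def] by (intro polynomial_function_add polynomial_function_sum) simp_all
qed

lemma polynomial_function_endo:
  assumes D: "D \<ge> 1" "\<And>i. degree (g i) \<le> D"
  shows "polynomial_function (D * (degree p + 2)) (\<lambda>y. endo y $ i)"
proof -
  have "degree p + 1 \<le> 1 * (degree p + 2)" by simp
  also have "\<dots> \<le> D * (degree p + 2)" using D(1) by (intro mult_right_mono) simp_all
  finally have Z: "polynomial_function (D * (degree p + 2)) (\<lambda>y. Z y j)" for j
    by (rule polynomial_function_mono[OF polynomial_function_Z])
  have "polynomial_function (D * (degree p + 2)) (\<lambda>y. poly (g i) (V y))"
    by (rule polynomial_function_mono[OF polynomial_function_poly[OF polynomial_function_V]])
       (intro mult_right_mono D(2), simp)
  moreover have "polynomial_function (D * (degree p + 2))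
      (\<lambda>y. if i = coord 0 then - (\<Sum>j=1..m. lam (coord j) * Z y j) else Z y (pos i))"
  proof (cases "i = coord 0")
    case True
    moreover have "polynomial_function (D * (degree p + 2)) (\<lambda>y. - (\<Sum>j=1..m. lam (coord j) * Z y j))"
      by (intro polynomial_function_uminus polynomial_function_sum polynomial_function_cmult Z)
    ultimately show ?thesis by simp
  qed (use Z in simp)
  ultimately show ?thesis
    by (simp add: endo_def polynomial_function_add)
qed

text \<open>
  The form \<open>lam\<close> turns the components of \<open>endo\<close> into \<open>V\<close>, so a bound for their degrees also
  bounds that of \<open>V\<close>. On the line \<open>x = t\<^sub>1 = s\<close> with all other \<open>t\<^sub>j = 0\<close> the sum in \<open>V\<close> has the
  single summand \<open>(s p(s) - 1) s\<close>, which leaves \<open>V = s\<^sup>2 p(s)\<close>.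
\<close>

lemma degree_endo_ge:
  assumes "\<And>i. polynomial_function d (\<lambda>y. endo y $ i)"
  shows "degree p + 2 \<le> d"
proof -
  have "polynomial_function d (\<lambda>y. \<Sum>i\<in>UNIV. lam i * endo y $ i)"
    by (intro polynomial_function_sum polynomial_function_cmult assms)
  then have V: "polynomial_function d V"
    by (simp add: functional_endo)
  define u where "u i = (if i = coord 0 \<or> i = coord 1 then [:0, 1:] else 0 :: 'k poly)" for i
  obtain q where q: "degree q \<le> d" "\<And>s. poly q s = V (\<chi> i. poly (u i) s)"
    by (rule polynomial_function_on_line[OF V, of u]) (auto simp: u_def)
  have "V (\<chi> i. poly (u i) s) = s ^ 2 * poly p s" for s
  proof -
    let ?y = "\<chi> i. poly (u i) s"
    \<comment> \<open>The line meets only the coordinates number \<open>0\<close> and \<open>1\<close>.\<close>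
    have "coord j \<noteq> coord 1 \<and> coord j \<noteq> coord 0" if "j \<in> {2..m}" for j
      using that m_pos pos_coord[of 1] pos_coord[of j] coord_eq_iff[of j] by auto
    then have "T ?y j = 0" if "j \<in> {2..m}" for j
      using that by (simp add: T_def u_def)
    then have "(\<Sum>j=1..m. Z ?y j * T ?y j) = Z ?y 1 * T ?y 1"
      using m_pos by (simp add: sum.atLeast_Suc_atMost numeral_2_eq_2)
    then show ?thesis
      by (simp add: V_def Z_def T_def u_def algebra_simps power2_eq_square)
  qed
  then have "poly q = poly ([:0, 1:] ^ 2 * p)"
    using q(2) by (simp add: fun_eq_iff)
  then have "q = [:0, 1:] ^ 2 * p"
    by (simp add: poly_eq_poly_eq_iff)
  with p_nz have "degree q = 2 + degree p"
    by (simp add: degree_mult_eq degree_power_eq)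
  with q(1) show ?thesis by simp
qed

end

text \<open>
  The prescribed first coordinate \<open>k\<close> will be one at which the linear form has coefficient \<open>1\<close>.
\<close>

lemma ex_numbering:
  obtains coord :: "nat \<Rightarrow> 'n::finite" and pos :: "'n \<Rightarrow> nat"
  where "coord 0 = k" "\<And>i. pos i \<le> CARD('n) - 1" "\<And>i. coord (pos i) = i"
    "\<And>j. j \<le> CARD('n) - 1 \<Longrightarrow> pos (coord j) = j"
proof -
  obtain h :: "nat \<Rightarrow> 'n" where h: "bij_betw h {0..<CARD('n)} UNIV"
    using ex_bij_betw_nat_finite[of "UNIV :: 'n set"] by auto
  define coord where "coord = Transposition.transpose (h 0) k \<circ> h"
  have coord: "bij_betw coord {0..<CARD('n)} UNIV"
    unfolding coord_def by (rule bij_betw_trans[OF h]) simp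
  let ?pos = "inv_into {0..<CARD('n)} coord"
  have card: "CARD('n) > 0" by simp
  show thesis
  proof (rule that[of coord ?pos])
    show "coord 0 = k" by (simp add: coord_def)
    show "?pos i \<le> CARD('n) - 1" for i
    proof -
      have "?pos i \<in> {0..<CARD('n)}"
        using bij_betwE[OF bij_betw_inv_into[OF coord]] by blast
      with card show ?thesis by auto
    qed
    show "coord (?pos i) = i" for i
      using bij_betw_inv_into_right[OF coord] by simp
    show "?pos (coord j) = j" if "j \<le> CARD('n) - 1" for j
          proof -
      have "j < CARD('n)" using that card by linarith
      then show ?thesis by (intro bij_betw_inv_into_left[OF coord]) simp
    qed
  qed
qed

lemma ex_morphism_omitting_curve_points:
  fixes g :: "'n::finite \<Rightarrow> 'k::{alg_closed_field, field_char_0} poly" and lam :: "'n \<Rightarrow> 'k"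
  assumes "CARD('n) \<ge> 2" and "finite S" and "lam k = 1"
    and "\<And>s. (\<Sum>i\<in>UNIV. lam i * poly (g i) s) = s"
    and D: "D \<ge> 1" "\<And>i. degree (g i) \<le> D"
  obtains f :: "('n, 'k) morphism"
  where "morphism_map f ` UNIV = UNIV - (\<lambda>s. \<chi> i. poly (g i) s) ` S"
    "morphism_degree f \<le> D * (card S + 2)" "card S + 2 \<le> morphism_degree f"
proof -
  obtain coord pos where "coord 0 = k" "\<And>i :: 'n. pos i \<le> CARD('n) - 1" "\<And>i. coord (pos i) = i"
    "\<And>j. j \<le> CARD('n) - 1 \<Longrightarrow> pos (coord j) = j"
    using ex_numbering by blast
  define p where "p = (\<Prod>s\<in>S. [:-s, 1:])"
  have p: "p \<noteq> 0" "degree p = card S" "{s. poly p s = 0} = S"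
    using \<open>finite S\<close> by (auto simp: p_def degree_prod_eq_sum_degree poly_prod)
  interpret numbered_coordinates coord pos "CARD('n) - 1" p lam g
    by standard (use assms p \<open>coord 0 = k\<close> \<open>\<And>i. pos i \<le> CARD('n) - 1\<close> \<open>\<And>i. coord (pos i) = i\<close>
      \<open>\<And>j. j \<le> CARD('n) - 1 \<Longrightarrow> pos (coord j) = j\<close> in auto)
  obtain f where f: "morphism_map f = endo" "morphism_degree f \<le> D * (degree p + 2)"
    using morphism_of_polynomial_functions[OF polynomial_function_endo[OF D]] by blast
  moreover have "degree p + 2 \<le> morphism_degree f"
    using polynomial_function_morphism_component[of f]
    by (intro degree_endo_ge) (simp add: f(1))
  ultimately show thesis
    by (intro that[of f]) (simp_all only: range_endo p)
qed

section \<open>Curves through a finite set\<close>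

lemma ex_interpolating_poly:
  fixes h :: "'k::field \<Rightarrow> 'k"
  assumes "finite S"
  shows "\<exists>q. degree q \<le> card S - 1 \<and> (\<forall>s\<in>S. poly q s = h s)"
  using assms
proof (induction S)
  case empty
  show ?case by (intro exI[of _ 0]) simp
next
  case (insert a S)
  then obtain q where q: "degree q \<le> card S - 1" "\<forall>s\<in>S. poly q s = h s" by blast
  define r where "r = (\<Prod>s\<in>S. [:-s, 1:])"
  have r: "degree r = card S" "poly r a \<noteq> 0" "\<forall>s\<in>S. poly r s = 0"
    using insert.hyps by (auto simp: r_def degree_prod_eq_sum_degree poly_prod)
  let ?q = "q + smult ((h a - poly q a) / poly r a) r"
  have "degree ?q \<le> card S"
    using q(1) r(1) by (intro degree_add_le order_trans[OF degree_smult_le]) simp_all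
  moreover have "\<forall>s\<in>insert a S. poly ?q s = h s"
    using q(2) r by auto
  ultimately show ?case
    using insert.hyps by (intro exI[of _ ?q]) simp
qed

text \<open>
  The powers of a scalar \<open>a\<close>, in a numbering that starts at \<open>k\<close>, can serve as coefficients. Such
  a form fails to separate \<open>x\<close> from \<open>y\<close> only if \<open>a\<close> is a root of the nonzero polynomial with
  coefficients \<open>x - y\<close>; finitely many pairs exclude finitely many \<open>a\<close>.
\<close>

lemma ex_separating_functional:
  fixes F :: "('k::field_char_0 ^ 'n::finite) set"
  assumes "finite F"
  obtains lam where "lam k = 1" "inj_on (\<lambda>x. \<Sum>i\<in>UNIV. lam i * x $ i) F"
proof -
  obtain coord pos where "coord 0 = k" "\<And>i :: 'n. pos i \<le> CARD('n) - 1" "\<And>i. coord (pos i) = i"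
    "\<And>j. j \<le> CARD('n) - 1 \<Longrightarrow> pos (coord j) = j"
    using ex_numbering by blast
  then have pos: "pos k = 0" "inj pos" by (metis le0, metis injI)
  define P where "P w = (\<Sum>i\<in>UNIV. monom (w $ i) (pos i))" for w :: "'k ^ 'n"
  have "coeff (P w) (pos i) = w $ i" for w i
    using pos(2) by (simp add: P_def coeff_sum inj_eq)
  then have P_nz: "P w \<noteq> 0" if "w \<noteq> 0" for w
    using that by (metis coeff_0 vec_eq_iff zero_index)
  \<comment> \<open>The scalars that fail to separate some pair.\<close>
  define B where "B = (\<Union>(x, y)\<in>{(x, y). x \<in> F \<and> y \<in> F \<and> x \<noteq> y}. {a. poly (P (x - y)) a = 0})"
  have "finite {(x, y). x \<in> F \<and> y \<in> F \<and> x \<noteq> y}"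
    by (rule finite_subset[of _ "F \<times> F"]) (use assms in auto)
  then have "finite B"
    unfolding B_def by (intro finite_UN_I) (auto intro!: poly_roots_finite P_nz)
  then obtain a where a: "a \<notin> B"
    using ex_new_if_finite[OF infinite_UNIV_char_0] by blast
  show thesis
  proof (rule that[of "\<lambda>i. a ^ pos i"])
    show "inj_on (\<lambda>x. \<Sum>i\<in>UNIV. a ^ pos i * x $ i) F"
    proof (rule inj_onI, rule ccontr)
      fix x y assume xy: "x \<in> F" "y \<in> F" "x \<noteq> y"
        and "(\<Sum>i\<in>UNIV. a ^ pos i * x $ i) = (\<Sum>i\<in>UNIV. a ^ pos i * y $ i)"
      then have "poly (P (x - y)) a = 0"
        by (simp add: P_def poly_sum poly_monom algebra_simps sum_subtractf)
      with a xy show False by (auto simp: B_def)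
    qed
  qed (simp add: pos)
qed

text \<open>
  A generic linear form \<open>L\<close> identifies \<open>F\<close> with a set \<open>S\<close> of scalars, and the coordinates of
  the points of \<open>F\<close> become functions on \<open>S\<close>. All but coordinate \<open>k\<close> are interpolated; the
  \<open>k\<close>-th component of the curve is solved for from the condition that \<open>L(g(s)) = s\<close> holds
  identically. On \<open>S\<close> it then takes the right values automatically. The identity contributes
  degree \<open>1\<close>, which accounts for the maximum when \<open>F\<close> has at most one point.
\<close>

lemma ex_morphism_omitting_finite_set:
  fixes F :: "('k::{alg_closed_field, field_char_0} ^ 'n::finite) set"
  assumes "CARD('n) \<ge> 2" and "finite F"
  obtains f :: "('n, 'k) morphism"
  where "morphism_map f ` UNIV = UNIV - F"
    "morphism_degree f \<le> max 1 (card F - 1) * (card F + 2)"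
proof -
  fix k :: 'n
  obtain lam :: "'n \<Rightarrow> 'k" where lam: "lam k = 1" and inj: "inj_on (\<lambda>x. \<Sum>i\<in>UNIV. lam i * x $ i) F"
    using ex_separating_functional[OF assms(2)] by blast
  define L where "L x = (\<Sum>i\<in>UNIV. lam i * x $ i)" for x :: "'k ^ 'n"
  define S where "S = L ` F"
  have inj: "inj_on L F" using inj by (simp add: L_def[abs_def])
  have S: "finite S" "card S = card F"
    using assms(2) inj by (simp_all add: S_def card_image)
  obtain q where q: "\<And>i. degree (q i) \<le> card S - 1"
    "\<And>i s. s \<in> S \<Longrightarrow> poly (q i) s = inv_into F L s $ i"
    using ex_interpolating_poly[OF S(1), of "\<lambda>s. inv_into F L s $ i" for i] by metis
  define g where "g i = (if i = k then [:0, 1:] - (\<Sum>j\<in>UNIV - {k}. smult (lam j) (q j)) else q i)" for i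
  have split: "(\<Sum>i\<in>UNIV. h i) = h k + (\<Sum>i\<in>UNIV - {k}. h i)" for h :: "'n \<Rightarrow> 'k"
    by (simp add: sum.remove)
  have L_g: "(\<Sum>i\<in>UNIV. lam i * poly (g i) s) = s" for s
    unfolding split by (simp add: g_def lam poly_sum)
  have "degree (g i) \<le> max 1 (card F - 1)" for i
  proof (cases "i = k")
    case True
    have "degree ([:0, 1:] - (\<Sum>j\<in>UNIV - {k}. smult (lam j) (q j))) \<le> max 1 (card F - 1)"
      by (intro degree_diff_le degree_sum_le order_trans[OF degree_smult_le])
         (use q(1) S in \<open>auto simp: le_max_iff_disj\<close>)
    then show ?thesis using True by (simp add: g_def)
  qed (use q(1) S in \<open>auto simp: g_def le_max_iff_disj\<close>)
  then obtain f :: "('n, 'k) morphism"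
    where f: "morphism_map f ` UNIV = UNIV - (\<lambda>s. \<chi> i. poly (g i) s) ` S"
      "morphism_degree f \<le> max 1 (card F - 1) * (card F + 2)"
    using ex_morphism_omitting_curve_points[OF assms(1) S(1) lam L_g max.cobounded1] S(2) by metis
  have "(\<chi> i. poly (g i) (L x)) = x" if "x \<in> F" for x
  proof -
    have g: "poly (g i) (L x) = x $ i" if "i \<noteq> k" for i
      using that \<open>x \<in> F\<close> inj q(2)[of "L x" i] by (simp add: g_def S_def)
    have "(\<Sum>i\<in>UNIV. lam i * poly (g i) (L x)) = (\<Sum>i\<in>UNIV. lam i * x $ i)"
      unfolding L_g by (simp add: L_def)
    then have "poly (g k) (L x) = x $ k"
      unfolding split by (simp add: lam g)
    with g show ?thesis by (metis (mono_tags, lifting) vec_eq_iff vec_lambda_beta)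
  qed
  then have "(\<lambda>s. \<chi> i. poly (g i) s) ` S = F"
    by (force simp: S_def image_image)
  with f that show thesis by simp
qed

text \<open>
  The parametrisation is normalised so that the parameter is the \<open>k\<close>-th coordinate. The
  coordinate form at \<open>k\<close> is then a left inverse of the line, viewed as a curve.
\<close>

lemma affine_line_parametrization:
  fixes L :: "('k::field ^ 'n::finite) set"
  assumes "affine_line L"
  obtains a d k where "d $ k = 1" "a $ k = 0" "L = range (\<lambda>s. a + s *s d)"
proof -
  obtain a V where V: "vec.subspace V" "vec.dim V = 1" and L: "L = (\<lambda>v. a + v) ` V"
    using assms by (auto simp: affine_line_def)
  obtain B where B: "B \<subseteq> V" "vec.independent B" "V \<subseteq> vec.span B" "card B = 1"
    using vec.basis_exists[of V] V(2) by metis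
  then obtain d where "B = {d}" by (auto simp: card_1_singleton_iff)
  with B have "d \<noteq> 0" and V_eq: "V = range (\<lambda>s. s *s d)"
    using vec.span_minimal[of B V] V(1) vec.dependent_single by (auto simp: vec.span_singleton)
  then obtain k where k: "d $ k \<noteq> 0" by (auto simp: vec_eq_iff)
  define d' where "d' = inverse (d $ k) *s d"
  define a' where "a' = a - (a $ k) *s d'"
  have "L \<subseteq> range (\<lambda>s. a' + s *s d')"
  proof -
    have "a + s *s d = a' + (a $ k + s * d $ k) *s d'" for s
      using k by (simp add: a'_def d'_def vec_eq_iff field_simps)
    then show ?thesis unfolding L V_eq image_image by blast
  qed
  moreover have "range (\<lambda>s. a' + s *s d') \<subseteq> L"
  proof -
    have "a' + s *s d' = a + ((s - a $ k) / d $ k) *s d" for s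
      using k by (simp add: a'_def d'_def vec_eq_iff field_simps)
    then show ?thesis unfolding L V_eq image_image by blast
  qed
  moreover have "d' $ k = 1" "a' $ k = 0" using k by (simp_all add: a'_def d'_def)
  ultimately show thesis using that by (metis subset_antisym)
qed

lemma ex_morphism_omitting_collinear_points:
  fixes F :: "('k::{alg_closed_field, field_char_0} ^ 'n::finite) set"
  assumes "CARD('n) \<ge> 2" and "finite F" and "affine_line L" "F \<subseteq> L"
  obtains f :: "('n, 'k) morphism"
  where "morphism_map f ` UNIV = UNIV - F" "morphism_degree f = card F + 2"
proof -
  obtain a d k where d: "d $ k = 1" "a $ k = 0" and L: "L = range (\<lambda>s. a + s *s d)"
    by (rule affine_line_parametrization[OF assms(3)])
  define S where "S = (\<lambda>x. x $ k) ` F"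
  have eq: "a + (x $ k) *s d = x" if "x \<in> F" for x
    using that assms(4) d by (auto simp: L)
  have "inj_on (\<lambda>x. x $ k) F"
    by (rule inj_onI) (metis eq)
  then have S: "finite S" "card S = card F"
    using assms(2) by (simp_all add: S_def card_image)
  define g where "g i = [:a $ i, d $ i:]" for i
  define lam where "lam i = (if i = k then 1 else 0 :: 'k)" for i
  have lam_g: "(\<Sum>i\<in>UNIV. lam i * poly (g i) s) = s" for s
  proof -
    have "(\<Sum>i\<in>UNIV. lam i * poly (g i) s) = (\<Sum>i\<in>UNIV. if i = k then poly (g i) s else 0)"
      by (rule sum.cong) (simp_all add: lam_def)
    then show ?thesis by (simp add: g_def d)
  qed
  obtain f :: "('n, 'k) morphism"
    where f: "morphism_map f ` UNIV = UNIV - (\<lambda>s. \<chi> i. poly (g i) s) ` S"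
      "morphism_degree f \<le> 1 * (card S + 2)" "card S + 2 \<le> morphism_degree f"
    by (rule ex_morphism_omitting_curve_points[where lam = lam and g = g and k = k and S = S and D = 1,
          OF assms(1) S(1) _ lam_g]) (auto simp: lam_def g_def)
  have "(\<chi> i. poly (g i) s) = a + s *s d" for s
    by (simp add: g_def vec_eq_iff)
  then have "(\<lambda>s. \<chi> i. poly (g i) s) ` S = F"
    using eq by (force simp: S_def image_image)
  with f S(2) that show thesis by simp
qed

theorem proposition1p5:
  fixes F :: "('k::{alg_closed_field, field_char_0} ^ 'n::finite) set"
    and l :: nat
  assumes "CARD('n) \<ge> 2"
    and "finite F"
    and "card F = l"
  shows "(\<exists>f :: ('n, 'k) morphism. morphism_map f ` UNIV = UNIV - F) \<and>
    (l > 2 \<longrightarrow>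
      (\<exists>f :: ('n, 'k) morphism. morphism_map f ` UNIV = UNIV - F \<and>
         morphism_degree f \<le> (l - 1) * (l + 2))) \<and>
    ((\<exists>L. affine_line L \<and> F \<subseteq> L) \<longrightarrow>
      (\<exists>f :: ('n, 'k) morphism. morphism_map f ` UNIV = UNIV - F \<and>
         morphism_degree f = l + 2))"
proof (intro conjI impI)
  obtain f :: "('n, 'k) morphism" where f: "morphism_map f ` UNIV = UNIV - F"
    "morphism_degree f \<le> max 1 (l - 1) * (l + 2)"
    using ex_morphism_omitting_finite_set[OF assms(1,2)] assms(3) by blast
  then show "\<exists>f :: ('n, 'k) morphism. morphism_map f ` UNIV = UNIV - F" by blast
  show "\<exists>f :: ('n, 'k) morphism. morphism_map f ` UNIV = UNIV - F \<and>
      morphism_degree f \<le> (l - 1) * (l + 2)" if "l > 2"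
    using f that by (auto simp: max_absorb2)
next
  assume "\<exists>L. affine_line L \<and> F \<subseteq> L"
  then show "\<exists>f :: ('n, 'k) morphism. morphism_map f ` UNIV = UNIV - F \<and> morphism_degree f = l + 2"
    using ex_morphism_omitting_collinear_points[OF assms(1,2)] assms(3) by metis
qed

end
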